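(* The diagram $\mathbf{E}_7^{(7)}$ has exactly $2$ orbits of labelings: 1. the orbit of zero, consisting of all the labelings with $1$ or $3$ components (including the component of the boxed 1); 2. the orbit consisting of all the labelings with $2$ or $4$ components (including the component of the boxed 1), with representative the labeling with $a_2=a_4=a_6=1$ and $a_1=a_3=a_5=a_7=0$.
   Context: $\mathbf{E}_7^{(7)}$ is the Dynkin diagram $\mathbf{E}_7$ with vertices $1,\dots,7$, edges $\{1,2\},\{2,3\},\{3,4\},\{4,5\},\{5,6\},\{4,7\}$, with vertex $7$ colored black. A labeling is $\boldsymbol a=(a_1,\dots,a_7)\in(\mathbb{Z}/2\mathbb{Z})^7$. The augmented diagram is obtained by adding one extra vertex (the "boxed 1"), joined by an edge to vertex $7$ only, carrying the constant label $1$. For $1\le i\le 7$ the move $\mathcal{M}_i$ changes only $a_i$, replacing it by $a_i$ plus the sum (in $\mathbb{Z}/2\mathbb{Z}$) of the labels of all neighbors of $i$ in the augmented diagram (including the boxed 1 when $i=7$). There is no move at the boxed vertex. Orbits are the equivalence classes of labelings under finite sequences of moves. Components of a labeling are the connected components of the subgraph of the augmented diagram induced on the vertices with label $1$, the boxed vertex included. *)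

theory Defs
  imports Main "HOL-Library.Z2"
begin

datatype vertex = V1 | V2 | V3 | V4 | V5 | V6 | V7

definition dynkin_edges :: "vertex set set" where
  "dynkin_edges = {{V1, V2}, {V2, V3}, {V3, V4}, {V4, V5}, {V5, V6}, {V4, V7}}"

definition black_vertices :: "vertex set" where
  "black_vertices = {V7}"

text \<open>In the augmented diagram \<open>None\<close> is the boxed vertex and \<open>Some v\<close> is the vertex
  \<open>v\<close> of the Dynkin diagram.\<close>

definition aug_edges :: "vertex option set set" where
  "aug_edges = (\<lambda>e. Some ` e) ` dynkin_edges \<union> {{Some v, None} | v. v \<in> black_vertices}"

type_synonym labeling = "vertex \<Rightarrow> bit"

definition aug_label :: "labeling \<Rightarrow> vertex option \<Rightarrow> bit" where
  "aug_label a x = (case x of None \<Rightarrow> 1 | Some v \<Rightarrow> a v)"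

definition move :: "vertex \<Rightarrow> labeling \<Rightarrow> labeling" where
  "move i a = a(i := a i + (\<Sum>x | {Some i, x} \<in> aug_edges. aug_label a x))"

definition move_rel :: "labeling rel" where
  "move_rel = {(a, move i a) | a i. True}"

text \<open>Every move is an involution, so reachability by moves is already symmetric.\<close>

definition orbit :: "labeling \<Rightarrow> labeling set" where
  "orbit a = move_rel\<^sup>* `` {a}"

definition orbits :: "labeling set set" where
  "orbits = UNIV // move_rel\<^sup>*"

definition support :: "labeling \<Rightarrow> vertex option set" where
  "support a = {x. aug_label a x = 1}"

definition induced_adj :: "labeling \<Rightarrow> vertex option rel" where
  "induced_adj a = {(x, y). x \<in> support a \<and> y \<in> support a \<and> {x, y} \<in> aug_edges}"

definition components :: "labeling \<Rightarrow> vertex option set set" where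
  "components a = support a // (induced_adj a)\<^sup>*"

definition rep :: labeling where
  "rep v = (if v \<in> {V2, V4, V6} then 1 else 0)"

end

theory Submission
  imports Defs
begin

text \<open>Rooted at the boxed vertex, the augmented diagram is a tree, so each component of a labeling
  has a unique vertex closest to the root. Counting these vertices expresses the number of
  components as a sum of local terms, from which one reads off that it lies between 1 and 4 and
  that every move preserves its parity. Hence there are at least two orbits. Conversely, whenever
  the neighbours of a vertex have odd sum, the label of that vertex can be set to any prescribed
  value; a suitable sequence of such assignments collapses all 128 labelings to two.\<close>

section \<open>The augmented diagram as a rooted tree\<close>

text \<open>The value \<open>None\<close> is the boxed vertex, not a missing parent: only the root
  itself has no parent.\<close>

fun parent :: "vertex \<Rightarrow> vertex option" where
  "parent V1 = Some V2"
| "parent V2 = Some V3"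
| "parent V3 = Some V4"
| "parent V4 = Some V7"
| "parent V5 = Some V4"
| "parent V6 = Some V5"
| "parent V7 = None"

fun depth :: "vertex option \<Rightarrow> nat" where
  "depth None = 0"
| "depth (Some V7) = 1"
| "depth (Some V4) = 2"
| "depth (Some V3) = 3"
| "depth (Some V5) = 3"
| "depth (Some V2) = 4"
| "depth (Some V6) = 4"
| "depth (Some V1) = 5"

lemma depth_parent: "depth (parent v) < depth (Some v)"
  by (cases v) simp_all

lemma UNIV_vertex: "UNIV = {V1, V2, V3, V4, V5, V6, V7}"
  by (auto intro: vertex.exhaust)

lemma aug_edges_eq: "aug_edges = range (\<lambda>v. {Some v, parent v})"
  by (simp add: aug_edges_def dynkin_edges_def black_vertices_def UNIV_vertex insert_commute)

lemma aug_edges_iff: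
  "{x, y} \<in> aug_edges \<longleftrightarrow>
    (\<exists>v. x = Some v \<and> y = parent v) \<or> (\<exists>v. y = Some v \<and> x = parent v)"
  by (auto simp: aug_edges_eq doubleton_eq_iff)

definition neighbor_sum :: "vertex \<Rightarrow> labeling \<Rightarrow> bit" where
  "neighbor_sum i a = (\<Sum>x | {Some i, x} \<in> aug_edges. aug_label a x)"

lemma neighbors_eq: "{x. {Some i, x} \<in> aug_edges} = insert (parent i) (Some ` {v. parent v = Some i})"
  by (auto simp: aug_edges_iff)

lemma children:
  "{v. parent v = Some V1} = {}"
  "{v. parent v = Some V2} = {V1}"
  "{v. parent v = Some V3} = {V2}"
  "{v. parent v = Some V4} = {V3, V5}"
  "{v. parent v = Some V5} = {V6}"
  "{v. parent v = Some V6} = {}"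
  "{v. parent v = Some V7} = {V4}"
  by (auto elim: parent.elims)

lemma aug_label_simps [simp]:
  "aug_label a None = 1"
  "aug_label a (Some v) = a v"
  by (simp_all add: aug_label_def)

lemma neighbor_sum_simps:
  "neighbor_sum V1 a = a V2"
  "neighbor_sum V2 a = a V1 + a V3"
  "neighbor_sum V3 a = a V2 + a V4"
  "neighbor_sum V4 a = a V3 + a V5 + a V7"
  "neighbor_sum V5 a = a V4 + a V6"
  "neighbor_sum V6 a = a V5"
  "neighbor_sum V7 a = a V4 + 1"
  by (auto simp: neighbor_sum_def neighbors_eq children ac_simps)

section \<open>Counting components\<close>

text \<open>The map \<open>t\<close> picks a canonical element of each class: it stays inside the
  class of its argument and is constant on it, so classes correspond to values of
  \<open>t\<close>.\<close>

lemma card_quotient_rtrancl: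
  assumes "sym r"
    and reach: "\<And>x. x \<in> S \<Longrightarrow> (x, t x) \<in> r\<^sup>*"
    and step: "\<And>x y. (x, y) \<in> r \<Longrightarrow> t x = t y"
  shows "card (S // r\<^sup>*) = card (t ` S)"
proof -
  have inv: "t x = t y" if "(x, y) \<in> r\<^sup>*" for x y
    using that by induction (auto dest: step)
  have equiv: "equiv UNIV (r\<^sup>*)"
    using \<open>sym r\<close> by (auto intro!: equivI refl_rtrancl sym_rtrancl trans_rtrancl)
  have "r\<^sup>* `` {x} = r\<^sup>* `` {t x}" if "x \<in> S" for x
    using equiv_class_eq [OF equiv reach [OF that]] .
  then have "S // r\<^sup>* = (\<lambda>z. r\<^sup>* `` {z}) ` t ` S"
    by (auto simp: quotient_def image_image)
  moreover have "inj_on (\<lambda>z. r\<^sup>* `` {z}) (t ` S)"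
  proof (rule inj_onI)
    fix u v
    assume "u \<in> t ` S" "v \<in> t ` S" and eq: "r\<^sup>* `` {u} = r\<^sup>* `` {v}"
    \<comment> \<open>If \<open>u\<close> is \<open>t x\<close>, then \<open>x\<close> reaches
      \<open>u\<close>, and constancy of \<open>t\<close> along \<open>r\<close> gives
      \<open>t u = t x\<close>.\<close>
    then have "t u = u" "t v = v"
      using inv [OF reach] by auto
    moreover from eq have "(u, v) \<in> r\<^sup>*"
      by auto
    ultimately show "u = v"
      using inv by metis
  qed
  ultimately show ?thesis
    by (simp add: card_image)
qed

text \<open>Climbs towards the root while labels stay 1. The label of the starting vertex is never
  inspected, so the result is the top of a component only for arguments in
  \<open>support a\<close>.\<close>

function top_vertex :: "labeling \<Rightarrow> vertex option \<Rightarrow> vertex option" where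
  "top_vertex a None = None"
| "top_vertex a (Some v) =
    (if aug_label a (parent v) = 1 then top_vertex a (parent v) else Some v)"
  by pat_completeness auto
termination
  by (relation "measure (depth \<circ> snd)") (simp_all add: depth_parent)

lemma sym_induced_adj: "sym (induced_adj a)"
  by (auto simp: induced_adj_def insert_commute intro!: symI)

lemma top_vertex_reachable:
  "x \<in> support a \<Longrightarrow> (x, top_vertex a x) \<in> (induced_adj a)\<^sup>*"
proof (induction a x rule: top_vertex.induct)
  case (2 a v)
  show ?case
  proof (cases "aug_label a (parent v) = 1")
    case True
    then have "parent v \<in> support a"
      by (simp add: support_def)
    moreover from this have "(Some v, parent v) \<in> induced_adj a"
      using "2.prems" by (auto simp: induced_adj_def aug_edges_iff)
    ultimately show ?thesis
      using 2 True by (simp add: converse_rtrancl_into_rtrancl)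
  qed simp
qed simp

text \<open>An edge joins a child to its parent; since the parent has label 1, the recursion at the
  child passes straight on to the parent.\<close>

lemma top_vertex_adj: "(x, y) \<in> induced_adj a \<Longrightarrow> top_vertex a x = top_vertex a y"
  by (auto simp: induced_adj_def aug_edges_iff support_def)

lemma top_vertex_image:
  "top_vertex a ` support a = insert None (Some ` {v. a v = 1 \<and> aug_label a (parent v) = 0})"
    (is "_ = ?T")
proof
  have "top_vertex a x \<in> ?T" if "x \<in> support a" for x
    using that by (induction a x rule: top_vertex.induct) (auto simp: support_def)
  then show "top_vertex a ` support a \<subseteq> ?T"
    by (rule image_subsetI)
  show "?T \<subseteq> top_vertex a ` support a"
  proof
    fix x assume "x \<in> ?T"
    then have "x \<in> support a" "top_vertex a x = x"
      by (auto simp: support_def)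
    then show "x \<in> top_vertex a ` support a"
      by (metis imageI)
  qed
qed

lemma card_components:
  "card (components a) =
    Suc (\<Sum>v\<in>UNIV. of_bool (a v = 1 \<and> aug_label a (parent v) = 0))"
proof -
  have fin: "finite (UNIV :: vertex set)"
    by (simp add: UNIV_vertex)
  have "card (components a) = card (top_vertex a ` support a)"
    unfolding components_def
    by (intro card_quotient_rtrancl sym_induced_adj top_vertex_reachable top_vertex_adj)
  also have "\<dots> = Suc (card {v. a v = 1 \<and> aug_label a (parent v) = 0})"
    using finite_subset [OF subset_UNIV fin]
    by (simp add: top_vertex_image card_insert_if card_image image_iff)
  finally show ?thesis
    using fin by (simp add: sum_of_bool_eq)
qed

text \<open>The leading 1 counts the component of the boxed vertex. \<open>V7\<close> contributes
  nothing, as its parent always has label 1.\<close>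

lemma card_components_eq:
  "card (components a) = 1 + of_bool (a V1 = 1 \<and> a V2 = 0) + of_bool (a V2 = 1 \<and> a V3 = 0)
    + of_bool (a V3 = 1 \<and> a V4 = 0) + of_bool (a V4 = 1 \<and> a V7 = 0)
    + of_bool (a V5 = 1 \<and> a V4 = 0) + of_bool (a V6 = 1 \<and> a V5 = 0)"
  by (simp add: card_components UNIV_vertex)

text \<open>The conditions for \<open>V1\<close> and \<open>V2\<close> exclude each other, as do
  those for \<open>V3\<close> and \<open>V4\<close> and those for \<open>V5\<close> and
  \<open>V6\<close>; hence at most three hold.\<close>

lemma card_components_le: "card (components a) \<le> 4"
  by (cases "a V2"; cases "a V4"; cases "a V5") (simp_all add: card_components_eq)

lemma card_components_parity:
  "card (components a) \<in> {1, 3} \<longleftrightarrow> odd (card (components a))"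
  "card (components a) \<in> {2, 4} \<longleftrightarrow> even (card (components a))"
proof -
  have "card (components a) \<in> {1, 2, 3, 4}"
    using card_components_le [of a] by (auto simp: card_components)
  then show
    "card (components a) \<in> {1, 3} \<longleftrightarrow> odd (card (components a))"
    "card (components a) \<in> {2, 4} \<longleftrightarrow> even (card (components a))"
    by auto
qed

section \<open>Moves and orbits\<close>

lemma move_eq: "move i a = a(i := a i + neighbor_sum i a)"
  by (simp add: move_def neighbor_sum_def)

text \<open>A move has an effect only if the number k of neighbors labeled 1 is odd. In a tree these
  lie in k different components when the vertex has label 0, and in a single one when it has label
  1, so the count changes by k - 1, which is even. The proof checks all cases.\<close>

lemma even_card_components_move:
  "even (card (components (move i a))) \<longleftrightarrow> even (card (components a))"
  by (cases i; cases "a V1"; cases "a V2"; cases "a V3"; cases "a V4"; cases "a V5";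
      cases "a V6"; cases "a V7")
    (simp_all add: card_components_eq move_eq neighbor_sum_simps)

lemma even_card_components_reachable:
  assumes "(a, b) \<in> move_rel\<^sup>*"
  shows "even (card (components a)) \<longleftrightarrow> even (card (components b))"
  using assms by induction (auto simp: move_rel_def even_card_components_move)

lemma neighbor_sum_upd: "neighbor_sum i (a(i := x)) = neighbor_sum i a"
  by (cases i) (simp_all add: neighbor_sum_simps)

lemma move_move: "move i (move i a) = a"
  by (cases "a i"; cases "neighbor_sum i a") (auto simp: move_eq neighbor_sum_upd)

lemma equiv_move_rel: "equiv UNIV (move_rel\<^sup>*)"
proof -
  have "sym move_rel"
    by (rule symI) (auto simp: move_rel_def, metis move_move)
  then show ?thesis
    by (auto intro!: equivI refl_rtrancl sym_rtrancl trans_rtrancl)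
qed

text \<open>Moves permute the labelings and so never merge two of them. Moving only when the label
  differs from a prescribed value does merge, so one fixed list can bring all labelings to few
  normal forms.\<close>

definition assign :: "vertex \<times> bit \<Rightarrow> labeling \<Rightarrow> labeling" where
  "assign p a = (if neighbor_sum (fst p) a = 1 then a(fst p := snd p) else a)"

lemma assign_reachable: "(a, assign p a) \<in> move_rel\<^sup>*"
proof -
  \<comment> \<open>When the neighbor sum is 1, the move flips the label, so the prescribed value is
    either already there or the result of the move.\<close>
  have "assign p a = a \<or> assign p a = move (fst p) a"
    by (cases "a (fst p)"; cases "snd p") (auto simp: assign_def move_eq)
  then show ?thesis
    by (auto simp: move_rel_def)
qed

lemma fold_assign_reachable: "(a, fold assign ps a) \<in> move_rel\<^sup>*"
  by (induction ps arbitrary: a) (auto intro: assign_reachable rtrancl_trans)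

text \<open>Explicit coordinates let all 128 labelings be enumerated and evaluated by
  rewriting.\<close>

fun labels :: "bit \<Rightarrow> bit \<Rightarrow> bit \<Rightarrow> bit \<Rightarrow> bit \<Rightarrow> bit \<Rightarrow> bit \<Rightarrow> labeling" where
  "labels a b c d e f g V1 = a"
| "labels a b c d e f g V2 = b"
| "labels a b c d e f g V3 = c"
| "labels a b c d e f g V4 = d"
| "labels a b c d e f g V5 = e"
| "labels a b c d e f g V6 = f"
| "labels a b c d e f g V7 = g"

lemma labels_eta: "labels (a V1) (a V2) (a V3) (a V4) (a V5) (a V6) (a V7) = a"
proof
  fix v show "labels (a V1) (a V2) (a V3) (a V4) (a V5) (a V6) (a V7) v = a v"
    by (cases v) simp_all
qed

lemma labels_upd:
  "(labels a b c d e f g)(V1 := x) = labels x b c d e f g"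
  "(labels a b c d e f g)(V2 := x) = labels a x c d e f g"
  "(labels a b c d e f g)(V3 := x) = labels a b x d e f g"
  "(labels a b c d e f g)(V4 := x) = labels a b c x e f g"
  "(labels a b c d e f g)(V5 := x) = labels a b c d x f g"
  "(labels a b c d e f g)(V6 := x) = labels a b c d e x g"
  "(labels a b c d e f g)(V7 := x) = labels a b c d e f x"
  by (rule ext, rename_tac v, case_tac v; simp)+

lemma assign_labels:
  "assign (V1, x) (labels a b c d e f g) = labels (if b = 1 then x else a) b c d e f g"
  "assign (V2, x) (labels a b c d e f g) = labels a (if a + c = 1 then x else b) c d e f g"
  "assign (V3, x) (labels a b c d e f g) = labels a b (if b + d = 1 then x else c) d e f g"
  "assign (V4, x) (labels a b c d e f g) = labels a b c (if c + e + g = 1 then x else d) e f g"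
  "assign (V5, x) (labels a b c d e f g) = labels a b c d (if d + f = 1 then x else e) f g"
  "assign (V6, x) (labels a b c d e f g) = labels a b c d e (if e = 1 then x else f) g"
  "assign (V7, x) (labels a b c d e f g) = labels a b c d e f (if d + 1 = 1 then x else g)"
  by (auto simp: assign_def neighbor_sum_simps labels_upd)

text \<open>The sequence was found by computer search.\<close>

definition collapse :: "(vertex \<times> bit) list" where
  "collapse =
    [(V1, 0), (V2, 0), (V3, 0), (V4, 0), (V7, 0), (V5, 1), (V6, 0), (V1, 1), (V2, 0), (V4, 1),
     (V5, 1), (V3, 1), (V4, 0), (V7, 1), (V5, 1), (V6, 0), (V4, 1), (V3, 0), (V5, 0), (V2, 1),
     (V1, 0), (V3, 1), (V4, 0), (V5, 1), (V4, 0), (V7, 0), (V2, 1), (V3, 0)]"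

text \<open>The two normal forms have 2 and 3 components, so by parity no moves can merge them
  further.\<close>

lemma fold_collapse_labels:
  "fold assign collapse (labels a b c d e f g) \<in>
    {labels 0 1 0 0 0 0 0, labels 0 1 0 0 1 0 0}"
  by (cases a; cases b; cases c; cases d; cases e; cases f; cases g)
    (simp_all add: collapse_def assign_labels)

lemma fold_collapse:
  "fold assign collapse a \<in> {labels 0 1 0 0 0 0 0, labels 0 1 0 0 1 0 0}"
  using fold_collapse_labels [of "a V1" "a V2" "a V3" "a V4" "a V5" "a V6" "a V7"]
  by (simp add: labels_eta)

lemma reachable_iff:
  "(a, b) \<in> move_rel\<^sup>* \<longleftrightarrow> (even (card (components a)) \<longleftrightarrow> even (card (components b)))"
proof
  assume *: "even (card (components a)) \<longleftrightarrow> even (card (components b))"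
  let ?n = "fold assign collapse"
  have "even (card (components (?n a))) \<longleftrightarrow> even (card (components (?n b)))"
    using * even_card_components_reachable [OF fold_assign_reachable] by metis
  moreover have "even (card (components (labels 0 1 0 0 0 0 0)))"
    "odd (card (components (labels 0 1 0 0 1 0 0)))"
    by (simp_all add: card_components_eq)
  \<comment> \<open>The two normal forms have opposite parity, so equal parity forces the same
    one.\<close>
  ultimately have "?n a = ?n b"
    using fold_collapse [of a] fold_collapse [of b] by auto
  then have "(?n a, b) \<in> move_rel\<^sup>*"
    using fold_assign_reachable [of b] equiv_move_rel by (metis equivE symD)
  with fold_assign_reachable show "(a, b) \<in> move_rel\<^sup>*"
    by (rule rtrancl_trans)
qed (rule even_card_components_reachable)

theorem proposition12p3:
  shows "card orbits = 2
    \<and> orbits = {orbit (\<lambda>_. 0), orbit rep}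
    \<and> orbit (\<lambda>_. 0) = {a. card (components a) \<in> {1, 3}}
    \<and> orbit rep = {a. card (components a) \<in> {2, 4}}"
proof -
  \<comment> \<open>The zero labeling has only the boxed component; in \<open>rep\<close> the
    vertices \<open>V2\<close>, \<open>V4\<close>, \<open>V6\<close> and the boxed one are pairwise
    nonadjacent, giving four.\<close>
  have zero: "odd (card (components (\<lambda>_. 0)))" and rep: "even (card (components rep))"
    by (simp_all add: card_components_eq rep_def)
  have orbit_eq: "orbit a = {b. even (card (components a)) \<longleftrightarrow> even (card (components b))}" for a
    by (auto simp: orbit_def reachable_iff)
  have orbit_zero: "orbit (\<lambda>_. 0) = {a. card (components a) \<in> {1, 3}}"
    unfolding card_components_parity orbit_eq using zero by simp
  have orbit_rep: "orbit rep = {a. card (components a) \<in> {2, 4}}"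
    unfolding card_components_parity orbit_eq using rep by simp
  have "orbits = range orbit"
    by (auto simp: orbits_def orbit_def quotient_def)
  also have "\<dots> = {orbit (\<lambda>_. 0), orbit rep}"
  proof
    have "orbit a = orbit (\<lambda>_. 0) \<or> orbit a = orbit rep" for a
      unfolding orbit_eq using zero rep by (cases "even (card (components a))") simp_all
    then show "range orbit \<subseteq> {orbit (\<lambda>_. 0), orbit rep}"
      by blast
  qed blast
  finally have orbits: "orbits = {orbit (\<lambda>_. 0), orbit rep}" .
  have "rep \<in> orbit rep" "rep \<notin> orbit (\<lambda>_. 0)"
    using zero rep by (simp_all add: orbit_eq)
  then have "orbit (\<lambda>_. 0) \<noteq> orbit rep"
    by auto
  then have "card orbits = 2"
    by (simp add: orbits)
  with orbits orbit_zero orbit_rep show ?thesis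
    by blast
qed

end
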